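(* For any $\epsilon>0$, there exists a linear congestion game with restricted altruistic social context $(\mathcal{G},\Gamma)$, normalized so that $\gamma_{ii}=1$ for all $i$, such that $\mathcal{G}$ is a load balancing game and $\Gamma$ is a symmetric boolean matrix (all entries in $\{0,1\}$), for which $\mathsf{PoA}(\mathcal{G},\Gamma)\ge\frac{17}{3}-\epsilon$.
   Context: Linear congestion game: a set of players $[n]=\{1,\dots,n\}$, $n\ge 2$, a finite set $E$ of resources, for each player $i$ a non-empty set $S_i\subseteq 2^E$ of strategies (each strategy is a non-empty subset of $E$), and for each $e\in E$ a latency function $\ell_e(x)=\alpha_e x+\beta_e$ with $\alpha_e,\beta_e\ge 0$. It is a load balancing game if every strategy of every player consists of exactly one resource. A strategy profile is $S=(s_1,\dots,s_n)$ with $s_i\in S_i$. The congestion of $e$ in $S$ is $n_e(S)=|\{j\in[n]:e\in s_j\}|$, and the cost of player $i$ in the underlying game is $c_i(S)=\sum_{e\in s_i}(\alpha_e n_e(S)+\beta_e)$. For $t\in S_i$, $S_{-i}\diamond t$ denotes the profile obtained from $S$ by replacing $s_i$ with $t$. A linear congestion game with altruistic social context is a pair $(\mathcal{G},\Gamma)$ where $\mathcal{G}$ is a linear congestion game with $n$ players and $\Gamma=(\gamma_{ij})\in\mathbb{R}^{n\times n}$ has non-negative entries; players and strategies are those of $\mathcal{G}$, but the cost of player $i$ in $S$ is $\widehat{c}_i(S)=\sum_{j\in[n]}\gamma_{ij}\,c_j(S)$. The social context is restricted if $\gamma_{ii}\ge\gamma_{ij}$ for all $i,j$; in this case it is normalized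 so that $\gamma_{ii}=1$ for every $i$. A pure Nash equilibrium of $(\mathcal{G},\Gamma)$ is a profile $S$ with $\widehat{c}_i(S)\le\widehat{c}_i(S_{-i}\diamond t)$ for every player $i$ and every $t\in S_i$. The social function is $\mathsf{SUM}(S)=\sum_{i\in[n]}c_i(S)$ (sum of the costs in the underlying game), and $S^*$ is a profile minimizing it. The price of anarchy $\mathsf{PoA}(\mathcal{G},\Gamma)$ is the maximum of $\mathsf{SUM}(S)/\mathsf{SUM}(S^* )$ over pure Nash equilibria $S$ of $(\mathcal{G},\Gamma)$. *)

theory Defs
  imports "HOL-Analysis.Analysis" "HOL-Library.FuncSet"
begin

text \<open>
  The latency of resource \<open>e\<close> is \<open>x \<mapsto> slope G e * x + offset G e\<close>.
  Players are the numbers \<open>1, \<dots>, num_players G\<close>; the values of \<open>strategies G\<close> outside this range,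
  and of \<open>slope G\<close>, \<open>offset G\<close> outside \<open>resources G\<close>, are irrelevant.
\<close>

record 'e congestion_game =
  num_players :: nat
  resources :: "'e set"
  strategies :: "nat \<Rightarrow> 'e set set"
  slope :: "'e \<Rightarrow> real"
  offset :: "'e \<Rightarrow> real"

definition players :: "'e congestion_game \<Rightarrow> nat set" where
  "players G = {1..num_players G}"

definition linear_congestion_game :: "'e congestion_game \<Rightarrow> bool" where
  "linear_congestion_game G \<longleftrightarrow>
     2 \<le> num_players G \<and>
     finite (resources G) \<and>
     (\<forall>i\<in>players G. strategies G i \<noteq> {} \<and>
        (\<forall>s\<in>strategies G i. s \<noteq> {} \<and> s \<subseteq> resources G)) \<and>
     (\<forall>e\<in>resources G. 0 \<le> slope G e \<and> 0 \<le> offset G e)"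

definition load_balancing_game :: "'e congestion_game \<Rightarrow> bool" where
  "load_balancing_game G \<longleftrightarrow>
     linear_congestion_game G \<and> (\<forall>i\<in>players G. \<forall>s\<in>strategies G i. card s = 1)"

text \<open>Profiles are extensional functions, so that each profile is represented exactly once.\<close>

definition profiles :: "'e congestion_game \<Rightarrow> (nat \<Rightarrow> 'e set) set" where
  "profiles G = PiE (players G) (strategies G)"

definition congestion :: "'e congestion_game \<Rightarrow> (nat \<Rightarrow> 'e set) \<Rightarrow> 'e \<Rightarrow> nat" where
  "congestion G S e = card {j \<in> players G. e \<in> S j}"

definition cost :: "'e congestion_game \<Rightarrow> nat \<Rightarrow> (nat \<Rightarrow> 'e set) \<Rightarrow> real" where
  "cost G i S = (\<Sum>e\<in>S i. slope G e * real (congestion G S e) + offset G e)"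

definition social_cost :: "'e congestion_game \<Rightarrow> (nat \<Rightarrow> 'e set) \<Rightarrow> real" where
  "social_cost G S = (\<Sum>i\<in>players G. cost G i S)"

definition optimal_social_cost :: "'e congestion_game \<Rightarrow> real" where
  "optimal_social_cost G = Min (social_cost G ` profiles G)"

text \<open>A social context is a matrix of which only the entries indexed by players matter.\<close>

type_synonym social_context = "nat \<Rightarrow> nat \<Rightarrow> real"

definition altruistic_context :: "'e congestion_game \<Rightarrow> social_context \<Rightarrow> bool" where
  "altruistic_context G \<Gamma> \<longleftrightarrow> (\<forall>i\<in>players G. \<forall>j\<in>players G. 0 \<le> \<Gamma> i j)"

definition restricted_context :: "'e congestion_game \<Rightarrow> social_context \<Rightarrow> bool" where
  "restricted_context G \<Gamma> \<longleftrightarrow>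
     altruistic_context G \<Gamma> \<and> (\<forall>i\<in>players G. \<forall>j\<in>players G. \<Gamma> i j \<le> \<Gamma> i i)"

definition normalized_context :: "'e congestion_game \<Rightarrow> social_context \<Rightarrow> bool" where
  "normalized_context G \<Gamma> \<longleftrightarrow> (\<forall>i\<in>players G. \<Gamma> i i = 1)"

definition symmetric_context :: "'e congestion_game \<Rightarrow> social_context \<Rightarrow> bool" where
  "symmetric_context G \<Gamma> \<longleftrightarrow> (\<forall>i\<in>players G. \<forall>j\<in>players G. \<Gamma> i j = \<Gamma> j i)"

definition boolean_context :: "'e congestion_game \<Rightarrow> social_context \<Rightarrow> bool" where
  "boolean_context G \<Gamma> \<longleftrightarrow> (\<forall>i\<in>players G. \<forall>j\<in>players G. \<Gamma> i j \<in> {0, 1})"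

definition perceived_cost ::
  "'e congestion_game \<Rightarrow> social_context \<Rightarrow> nat \<Rightarrow> (nat \<Rightarrow> 'e set) \<Rightarrow> real" where
  "perceived_cost G \<Gamma> i S = (\<Sum>j\<in>players G. \<Gamma> i j * cost G j S)"

definition pure_nash_equilibria ::
  "'e congestion_game \<Rightarrow> social_context \<Rightarrow> (nat \<Rightarrow> 'e set) set" where
  "pure_nash_equilibria G \<Gamma> =
     {S \<in> profiles G. \<forall>i\<in>players G. \<forall>t\<in>strategies G i.
        perceived_cost G \<Gamma> i S \<le> perceived_cost G \<Gamma> i (S(i := t))}"

text \<open>
  The price of anarchy is meaningful only if there is an equilibrium (otherwise this is \<open>Max {}\<close>)
  and the optimal social cost is nonzero (otherwise all the quotients are \<open>0\<close> by convention).
\<close>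

definition price_of_anarchy :: "'e congestion_game \<Rightarrow> social_context \<Rightarrow> real" where
  "price_of_anarchy G \<Gamma> =
     Max ((\<lambda>S. social_cost G S / optimal_social_cost G) ` pure_nash_equilibria G \<Gamma>)"

text \<open>The minimum and the maximum above range over finite sets, and the former over a nonempty one.\<close>

lemma finite_profiles:
  assumes "linear_congestion_game G"
  shows "finite (profiles G)"
proof -
  have "finite (strategies G i)" if "i \<in> players G" for i
  proof (rule finite_subset)
    show "strategies G i \<subseteq> Pow (resources G)"
      using assms that by (auto simp: linear_congestion_game_def)
    show "finite (Pow (resources G))"
      using assms by (simp add: linear_congestion_game_def)
  qed
  then show ?thesis
    unfolding profiles_def by (intro finite_PiE) (auto simp: players_def)
qed

lemma profiles_nonempty:
  assumes "linear_congestion_game G"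
  shows "profiles G \<noteq> {}"
  using assms by (simp add: profiles_def linear_congestion_game_def PiE_eq_empty_iff)

lemma finite_pure_nash_equilibria:
  assumes "linear_congestion_game G"
  shows "finite (pure_nash_equilibria G \<Gamma>)"
  by (rule finite_subset[OF _ finite_profiles[OF assms]]) (auto simp: pure_nash_equilibria_def)

end

theory Submission
  imports Defs
begin

text \<open>
  The players are the edges of a rooted tree whose vertices are the resources: each player chooses
  the upper or the lower end of its edge, and its friends are the players of the edges directly above
  and directly below. If everybody plays the upper end, a deviating player meets only friends on the
  new resource and leaves none behind, so this profile is an equilibrium as soon as
  \<open>w u * deg u \<le> w v * (2 * deg v + 1)\<close> for every edge from \<open>u\<close> down to \<open>v\<close>, where \<open>w\<close> are the slopes
  and \<open>deg\<close> counts children. Its social cost is the sum of \<open>w v * (deg v)\<^sup>2\<close>; if everybody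
  plays the lower end, it is the sum of \<open>w v\<close> over the vertices below the root.
  Take \<open>n\<close> levels of degree 3, \<open>n\<close> levels of degree 2 and a level of leaves, with equality in the
  condition: the total slope of a level grows by the factor \<open>9 / 7\<close> in the first part and shrinks by
  \<open>4 / 5\<close> in the second, so that root and leaves are negligible and the ratio tends to \<open>17 / 3\<close>.
\<close>

definition attains_poa :: "real \<Rightarrow> bool" where
  "attains_poa x \<longleftrightarrow> (\<exists>(G :: nat congestion_game) (\<Gamma> :: social_context).
     linear_congestion_game G \<and> load_balancing_game G \<and>
     restricted_context G \<Gamma> \<and> normalized_context G \<Gamma> \<and>
     symmetric_context G \<Gamma> \<and> boolean_context G \<Gamma> \<and>
     pure_nash_equilibria G \<Gamma> \<noteq> {} \<and> optimal_social_cost G > 0 \<and>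
     price_of_anarchy G \<Gamma> \<ge> x)"

lemma attains_poa_mono: "attains_poa x \<Longrightarrow> y \<le> x \<Longrightarrow> attains_poa y"
  unfolding attains_poa_def by (meson order_trans)

section \<open>The game on a numbered tree: equilibrium and social costs\<close>

locale tree_game =
  fixes N :: nat and par :: "nat \<Rightarrow> nat" and w :: "nat \<Rightarrow> real"
  assumes two_le_N: "2 \<le> N"
    and w_pos: "v \<le> N \<Longrightarrow> 0 < w v"
    and par_le: "p \<in> {1..N} \<Longrightarrow> par p \<le> N"
    and par_neq: "p \<in> {1..N} \<Longrightarrow> par p \<noteq> p"
    and par_par_neq: "p \<in> {1..N} \<Longrightarrow> par (par p) \<noteq> p"
    and w_balance: "p \<in> {1..N} \<Longrightarrow>
      w (par p) * card {q \<in> {1..N}. par q = par p} \<le> w p * (2 * card {q \<in> {1..N}. par q = p} + 1)"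
begin

abbreviation deg :: "nat \<Rightarrow> nat" where
  "deg v \<equiv> card {q \<in> {1..N}. par q = v}"

definition game :: "nat congestion_game" where
  "game = \<lparr>num_players = N, resources = {0..N}, strategies = (\<lambda>i. {{par i}, {i}}),
           slope = w, offset = (\<lambda>_. 0)\<rparr>"

text \<open>Player \<open>i\<close> is the edge from \<open>i\<close> up to \<open>par i\<close> and
  bears the number of its lower end. So \<open>par i\<close> also names the player of the edge
  directly above, unless it is the root \<open>0\<close>, which is no player. Siblings are not
  friends.\<close>

definition context_matrix :: social_context where
  "context_matrix i j = (if i = j \<or> par i = j \<or> par j = i then 1 else 0)"

definition up :: "nat \<Rightarrow> nat set" where
  "up = (\<lambda>i\<in>{1..N}. {par i})"

definition down :: "nat \<Rightarrow> nat set" where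
  "down = (\<lambda>i\<in>{1..N}. {i})"

lemma players_game [simp]: "players game = {1..N}"
  by (simp add: players_def game_def)

lemma strategies_game [simp]: "strategies game i = {{par i}, {i}}"
  by (simp add: game_def)

lemma linear_game: "linear_congestion_game game"
  using two_le_N par_le
  by (auto simp: linear_congestion_game_def game_def players_def intro: less_imp_le[OF w_pos])

lemma load_balancing: "load_balancing_game game"
  using linear_game by (auto simp: load_balancing_game_def)

lemma up_profile: "up \<in> profiles game"
  by (auto simp: profiles_def up_def)

lemma down_profile: "down \<in> profiles game"
  by (auto simp: profiles_def down_def)

lemma cost_singleton: "S j = {e} \<Longrightarrow> cost game j S = w e * congestion game S e"
  by (simp add: cost_def game_def)

lemma congestion_up: "congestion game up v = deg v"
  unfolding congestion_def by (rule arg_cong[where f = card]) (auto simp: up_def)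

lemma congestion_down: "i \<in> {1..N} \<Longrightarrow> congestion game down i = 1"
proof -
  assume "i \<in> {1..N}"
  then have "{j \<in> players game. i \<in> down j} = {i}"
    by (auto simp: down_def)
  then show ?thesis
    by (simp add: congestion_def)
qed

lemma cost_up:
  assumes "i \<in> {1..N}"
  shows "cost game i up = w (par i) * deg (par i)"
proof -
  have "up i = {par i}"
    using assms by (simp add: up_def)
  then show ?thesis
    using cost_singleton congestion_up by simp
qed

lemma cost_down:
  assumes "i \<in> {1..N}"
  shows "cost game i down = w i"
proof -
  have "down i = {i}"
    using assms by (simp add: down_def)
  then show ?thesis
    using cost_singleton congestion_down[OF assms] by simp
qed

text \<open>Only \<open>par i\<close> loses a player; it can be left out because after the move
  neither the deviator nor any of its friends plays it.\<close>

lemma congestion_deviation: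
  assumes i: "i \<in> {1..N}" and v: "v \<noteq> par i"
  shows "congestion game (up(i := {i})) v = (if v = i then deg i + 1 else deg v)"
proof -
  have "{j \<in> players game. v \<in> (up(i := {i})) j} =
      (if v = i then insert i {q \<in> {1..N}. par q = v} else {q \<in> {1..N}. par q = v})"
    using i v by (auto simp: up_def)
  then show ?thesis
    using par_neq[OF i] by (auto simp: congestion_def)
qed

text \<open>When \<open>i\<close> moves down, its own cost changes from
  \<open>w (par i) * deg (par i)\<close> to \<open>w i * (deg i + 1)\<close>, each of its
  \<open>deg i\<close> friends below pays \<open>w i\<close> more, and the friend above is
  unaffected. So \<open>w_balance\<close> says exactly that the move does not pay.\<close>

lemma up_equilibrium: "up \<in> pure_nash_equilibria game context_matrix"
proof -
  have "perceived_cost game context_matrix i up \<le> perceived_cost game context_matrix i (up(i := {i}))"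
    if i: "i \<in> {1..N}" for i
  proof -
    define T where "T = up(i := {i})"
    have diff: "context_matrix i j * (cost game j T - cost game j up) =
        (if j = i then w i * (deg i + 1) - w (par i) * deg (par i) else 0) +
        (if par j = i then w i else 0)" if j: "j \<in> {1..N}" for j
    proof (cases "j = i")
      case True
      have "cost game i T = w i * (deg i + 1)"
        using congestion_deviation[OF i, of i] par_neq[OF i]
        by (subst cost_singleton[where e = i]) (auto simp: T_def)
      then show ?thesis
        using True par_neq[OF i] cost_up[OF i] by (simp add: context_matrix_def)
    next
      case False
      have cost_T: "cost game j T = w (par j) * congestion game T (par j)"
        using j False by (intro cost_singleton) (simp add: T_def up_def)
      show ?thesis
      proof (cases "par j = i \<or> par i = j")
        case True
        \<comment> \<open>A friend stays on a resource other than \<open>par i\<close>, so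
          \<open>congestion_deviation\<close> applies; \<open>par_par_neq\<close> keeps the friend
          above off resource \<open>i\<close>.\<close>
        then have "par j \<noteq> par i"
          using par_neq[OF i] par_neq[OF j] by auto
        then show ?thesis
          using False True par_par_neq[OF i] congestion_deviation[OF i, of "par j", folded T_def]
          by (auto simp: cost_T cost_up[OF j] context_matrix_def algebra_simps)
      next
        case False
        \<comment> \<open>Non-friends, among them the siblings relieved by the move, have weight
          \<open>0\<close>.\<close>
        then show ?thesis
          using \<open>j \<noteq> i\<close> by (auto simp: context_matrix_def)
      qed
    qed
    have "perceived_cost game context_matrix i T - perceived_cost game context_matrix i up =
        (\<Sum>j\<in>{1..N}. context_matrix i j * (cost game j T - cost game j up))"
      by (simp add: perceived_cost_def right_diff_distrib sum_subtractf)
    also have "\<dots> = (\<Sum>j\<in>{1..N}.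
        (if j = i then w i * (deg i + 1) - w (par i) * deg (par i) else 0) +
        (if par j = i then w i else 0))"
      using diff by (intro sum.cong) auto
    also have "\<dots> = w i * (deg i + 1) - w (par i) * deg (par i) + deg i * w i"
      using i by (simp add: sum.distrib flip: sum.inter_filter)
    also have "\<dots> \<ge> 0"
      using w_balance[OF i] by (simp add: algebra_simps)
    finally show ?thesis
      by (simp add: T_def)
  qed
  moreover have "up(i := {par i}) = up" if "i \<in> {1..N}" for i
    using that by (auto simp: up_def fun_eq_iff)
  ultimately show ?thesis
    using up_profile by (auto simp: pure_nash_equilibria_def)
qed

text \<open>Players are grouped by their upper end: \<open>deg v\<close> players share
  \<open>v\<close>, and each of them pays \<open>w v * deg v\<close>.\<close>

lemma social_cost_up: "social_cost game up = (\<Sum>v\<in>{0..N}. w v * (deg v)\<^sup>2)"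
proof -
  have "social_cost game up = (\<Sum>i\<in>{1..N}. w (par i) * deg (par i))"
    unfolding social_cost_def
    by (simp add: cost_up)
  also have "\<dots> = (\<Sum>v\<in>{0..N}. \<Sum>i\<in>{i \<in> {1..N}. par i = v}. w (par i) * deg (par i))"
    using par_le by (intro sum.group[symmetric]) auto
  also have "\<dots> = (\<Sum>v\<in>{0..N}. w v * (deg v)\<^sup>2)"
    by (intro sum.cong) (auto simp: power2_eq_square)
  finally show ?thesis .
qed

lemma social_cost_down: "social_cost game down = (\<Sum>i\<in>{1..N}. w i)"
  by (simp add: social_cost_def cost_down)

text \<open>A player always counts in the congestion of its own resource, and all slopes are
  positive. This makes the optimum positive and the quotients genuine.\<close>

lemma social_cost_pos:
  assumes S: "S \<in> profiles game"
  shows "0 < social_cost game S"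
  unfolding social_cost_def
proof (rule sum_pos)
  fix i assume i: "i \<in> players game"
  then have "S i \<in> {{par i}, {i}}"
    using S PiE_mem[of S "players game" "strategies game" i] by (simp add: profiles_def)
  then obtain e where e: "S i = {e}" "e \<le> N"
    using i par_le by auto
  have "i \<in> {j \<in> players game. e \<in> S j}"
    using i e by auto
  then have "0 < congestion game S e"
    unfolding congestion_def by (subst card_gt_0_iff) auto
  then show "0 < cost game i S"
    using w_pos[OF e(2)] e by (simp add: cost_singleton)
qed (use two_le_N in auto)

lemma optimal_social_cost_pos: "0 < optimal_social_cost game"
  unfolding optimal_social_cost_def
  using finite_profiles[OF linear_game] profiles_nonempty[OF linear_game] social_cost_pos by simp

text \<open>It suffices that \<open>down\<close> bounds the optimum from above: a larger denominator
  only lowers the ratio, and the ratio of the equilibrium \<open>up\<close> is at most the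
  maximum.\<close>

lemma price_of_anarchy_ge:
  "(\<Sum>v\<in>{0..N}. w v * (deg v)\<^sup>2) / (\<Sum>i\<in>{1..N}. w i) \<le> price_of_anarchy game context_matrix"
proof -
  have "optimal_social_cost game \<le> social_cost game down"
    unfolding optimal_social_cost_def
    using finite_profiles[OF linear_game] down_profile by (intro Min_le) auto
  then have "social_cost game up / social_cost game down \<le>
      social_cost game up / optimal_social_cost game"
    using optimal_social_cost_pos social_cost_pos[OF up_profile] by (intro divide_left_mono) auto
  also have "\<dots> \<le> price_of_anarchy game context_matrix"
    unfolding price_of_anarchy_def
    using finite_pure_nash_equilibria[OF linear_game] up_equilibrium by (intro Max_ge) auto
  finally show ?thesis
    by (simp add: social_cost_up social_cost_down)
qed

lemma attains_poa_ratio: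
  "attains_poa ((\<Sum>v\<in>{0..N}. w v * (deg v)\<^sup>2) / (\<Sum>i\<in>{1..N}. w i))"
  unfolding attains_poa_def
  using linear_game load_balancing up_equilibrium optimal_social_cost_pos price_of_anarchy_ge
  by (intro exI[of _ game] exI[of _ context_matrix])
    (auto simp: restricted_context_def altruistic_context_def normalized_context_def
      symmetric_context_def boolean_context_def context_matrix_def)

end

section \<open>Transfer to finite trees with arbitrary vertices\<close>

lemma attains_poa_tree:
  fixes V :: "'a set" and r :: 'a and par :: "'a \<Rightarrow> 'a" and w :: "'a \<Rightarrow> real" and d :: "'a \<Rightarrow> nat"
  assumes V: "finite V" "r \<in> V" "3 \<le> card V"
    and w: "\<And>v. v \<in> V \<Longrightarrow> 0 < w v"
    and par: "\<And>v. v \<in> V \<Longrightarrow> par v \<in> V" "par r = r"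
      "\<And>v. v \<in> V - {r} \<Longrightarrow> par v \<noteq> v" "\<And>v. v \<in> V - {r} \<Longrightarrow> par (par v) \<noteq> v"
    and d: "\<And>v. v \<in> V \<Longrightarrow> card {u \<in> V - {r}. par u = v} = d v"
    and balance: "\<And>v. v \<in> V - {r} \<Longrightarrow> w (par v) * d (par v) \<le> w v * (2 * d v + 1)"
  shows "attains_poa ((\<Sum>v\<in>V. w v * (d v)\<^sup>2) / (\<Sum>v\<in>V - {r}. w v))"
proof -
  define N where "N = card (V - {r})"
  obtain h0 where h0: "bij_betw h0 {1..N} (V - {r})"
    using ex_bij_betw_nat_finite_1[of "V - {r}"] V by (auto simp: N_def)
  \<comment> \<open>Number \<open>0\<close> goes to the root, so the players \<open>1\<close> to
    \<open>N\<close> are exactly the non-root vertices, each standing for the edge to its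
    parent.\<close>
  define h where "h = h0(0 := r)"
  have h1: "bij_betw h {1..N} (V - {r})"
    using h0 by (rule bij_betw_cong[THEN iffD1, rotated]) (auto simp: h_def)
  have "bij_betw h ({1..N} \<union> {0}) ((V - {r}) \<union> {r})"
    using h1 by (intro bij_betw_combine) (auto simp: h_def bij_betw_def)
  moreover have "{1..N} \<union> {0} = {0..N}" "(V - {r}) \<union> {r} = V"
    using V by auto
  ultimately have h: "bij_betw h {0..N} V"
    by simp
  define g where "g = inv_into {0..N} h"
  have hg: "h (g v) = v" if "v \<in> V" for v
    using h that by (simp add: g_def bij_betw_inv_into_right)
  have gh: "g (h p) = p" if "p \<le> N" for p
    using h that by (simp add: g_def bij_betw_inv_into_left)
  have g_le: "g v \<le> N" if "v \<in> V" for v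
    using bij_betwE[OF bij_betw_inv_into[OF h]] that by (auto simp: g_def)
  have hV: "h p \<in> V" if "p \<le> N" for p
    using bij_betwE[OF h] that by auto
  have hV': "h p \<in> V - {r}" if "p \<in> {1..N}" for p
    using bij_betwE[OF h1] that by auto
  define par' where "par' = g \<circ> par \<circ> h"
  have h_par': "h (par' p) = par (h p)" if "p \<le> N" for p
    using that by (simp add: par'_def hg hV par)
  have par'_eq: "par' p = v \<longleftrightarrow> par (h p) = h v" if "p \<le> N" "v \<le> N" for p v
    using that gh hg hV par by (metis comp_apply par'_def)
  have par'_le: "par' p \<le> N" if "p \<le> N" for p
    using that by (simp add: par'_def g_le hV par)
  have deg: "card {q \<in> {1..N}. par' q = v} = d (h v)" if v: "v \<le> N" for v
  proof -
    \<comment> \<open>The numbering maps children to children; the root is left out on both sides,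
      although \<open>par r = r\<close>.\<close>
    have "bij_betw h {q \<in> {1..N}. par' q = v} {u \<in> V - {r}. par u = h v}"
      unfolding bij_betw_def
    proof
      show "inj_on h {q \<in> {1..N}. par' q = v}"
        using bij_betw_imp_inj_on[OF h1] by (rule inj_on_subset) auto
      have "{u \<in> V - {r}. par u = h v} = {u \<in> h ` {1..N}. par u = h v}"
        using bij_betw_imp_surj_on[OF h1] by simp
      also have "\<dots> = h ` {q \<in> {1..N}. par (h q) = h v}"
        by blast
      also have "{q \<in> {1..N}. par (h q) = h v} = {q \<in> {1..N}. par' q = v}"
        using par'_eq v by auto
      finally show "h ` {q \<in> {1..N}. par' q = v} = {u \<in> V - {r}. par u = h v}" ..
    qed
    from bij_betw_same_card[OF this] show ?thesis
      using d[OF hV[OF v]] by simp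
  qed
  interpret tree_game N par' "w \<circ> h"
  proof
    show "2 \<le> N"
      using V by (simp add: N_def)
    show "0 < (w \<circ> h) v" if "v \<le> N" for v
      using that w hV by simp
    fix p assume p: "p \<in> {1..N}"
    then have p': "p \<le> N" by simp
    show "par' p \<le> N"
      using par'_le p' .
    show "par' p \<noteq> p"
      using par'_eq[OF p' p'] par(3)[OF hV'[OF p]] by simp
    show "par' (par' p) \<noteq> p"
      using par'_eq[OF par'_le[OF p'] p'] par(4)[OF hV'[OF p]] h_par'[OF p'] by simp
    show "(w \<circ> h) (par' p) * card {q \<in> {1..N}. par' q = par' p} \<le>
        (w \<circ> h) p * (2 * card {q \<in> {1..N}. par' q = p} + 1)"
      using balance[OF hV'[OF p]] deg[OF p'] deg[OF par'_le[OF p']] h_par'[OF p'] by simp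
  qed
  have "(\<Sum>v\<in>{0..N}. (w \<circ> h) v * (deg v)\<^sup>2) = (\<Sum>v\<in>{0..N}. w (h v) * (d (h v))\<^sup>2)"
    using deg by (intro sum.cong) auto
  also have "\<dots> = (\<Sum>v\<in>V. w v * (d v)\<^sup>2)"
    by (rule sum.reindex_bij_betw[OF h])
  finally have "(\<Sum>v\<in>{0..N}. (w \<circ> h) v * (deg v)\<^sup>2) = (\<Sum>v\<in>V. w v * (d v)\<^sup>2)" .
  moreover have "(\<Sum>i\<in>{1..N}. (w \<circ> h) i) = (\<Sum>v\<in>V - {r}. w v)"
    using sum.reindex_bij_betw[OF h1, of w] by simp
  ultimately show ?thesis
    using attains_poa_ratio by simp
qed

section \<open>Trees with constant degree on each level\<close>

text \<open>\<open>A l\<close> is the total slope of level \<open>l\<close>, whose vertices all have \<open>d l\<close> children.\<close>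

lemma attains_poa_levels:
  fixes L :: nat and d :: "nat \<Rightarrow> nat" and A :: "nat \<Rightarrow> real"
  assumes L: "1 \<le> L" and d: "\<And>l. l < L \<Longrightarrow> 2 \<le> d l" "d L = 0"
    and A: "\<And>l. l \<le> L \<Longrightarrow> 0 < A l"
    and balance: "\<And>l. l < L \<Longrightarrow> A l * (d l)\<^sup>2 = A (Suc l) * (2 * d (Suc l) + 1)"
  shows "attains_poa ((\<Sum>l\<le>L. A l * (d l)\<^sup>2) / (\<Sum>l\<in>{1..L}. A l))"
proof -
  \<comment> \<open>\<open>m l\<close> is the number of vertices on level \<open>l\<close>.\<close>
  define m where "m l = (\<Prod>i<l. d i)" for l
  have m_0: "m 0 = 1" and m_Suc: "m (Suc l) = m l * d l" for l
    by (simp_all add: m_def)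
  have m_pos: "0 < m l" if "l \<le> L" for l
    unfolding m_def
  proof (rule prod_pos)
    show "0 < d i" if "i \<in> {..<l}" for i
      using d(1)[of i] that \<open>l \<le> L\<close> by simp
  qed
  define V where "V = Sigma {..L} (\<lambda>l. {..<m l})"
  \<comment> \<open>For \<open>l < L\<close> the children of \<open>(l, k)\<close> are the pairs
    \<open>(Suc l, k')\<close> with \<open>k' div d l = k\<close>. At \<open>(0, 0)\<close>
    truncated subtraction and \<open>0 div d 0 = 0\<close> make the root its own parent.\<close>
  define par where "par = (\<lambda>(l, k). (l - 1 :: nat, k div d (l - 1)))"
  define w where "w = (\<lambda>(l, k :: nat). A l / m l)"
  have V_Suc: "\<exists>l k. v = (Suc l, k) \<and> Suc l \<le> L \<and> k < m l * d l" if v: "v \<in> V - {(0, 0)}" for v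
  proof (cases v)
    case (Pair l k)
    then show ?thesis
      using v by (cases l) (auto simp: V_def m_0 m_Suc)
  qed
  have mem_V [simp]: "(l, k) \<in> V \<longleftrightarrow> l \<le> L \<and> k < m l" for l k
    by (simp add: V_def)
  have fin: "finite V"
    by (simp add: V_def)
  \<comment> \<open>The root and two of its children, available because \<open>d 0\<close> is at
    least 2, ensure two players.\<close>
  have "{(0, 0), (1, 0), (1, 1)} \<subseteq> V"
    using L d(1)[of 0] m_Suc[of 0] by (auto simp: m_0)
  from card_mono[OF fin this] have card_V: "3 \<le> card V"
    by simp
  have deg: "card {u \<in> V - {(0, 0)}. par u = v} = d (fst v)" if v: "v \<in> V" for v
  proof -
    obtain l k where lk: "v = (l, k)" "l \<le> L" "k < m l"
      using v by (cases v) auto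
    have "{u \<in> V - {(0, 0)}. par u = v} = Pair (Suc l) ` {d l * k..<d l * Suc k}"
    proof (intro set_eqI iffI)
      fix u assume u: "u \<in> {u \<in> V - {(0, 0)}. par u = v}"
      then obtain l' k' where u': "u = (Suc l', k')" "Suc l' \<le> L" "k' < m l' * d l'"
        using V_Suc by blast
      then have "l' = l" "k' div d l = k" "0 < d l"
        using u lk d(1)[of l'] by (auto simp: par_def)
      then show "u \<in> Pair (Suc l) ` {d l * k..<d l * Suc k}"
        using u' by (auto simp: dividend_less_times_div mult.commute)
    next
      fix u assume "u \<in> Pair (Suc l) ` {d l * k..<d l * Suc k}"
      then obtain k' where u: "u = (Suc l, k')" "d l * k \<le> k'" "k' < d l * Suc k"
        by auto
      \<comment> \<open>A nonempty interval of children forces \<open>d l > 0\<close>, which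
        excludes the leaf level.\<close>
      then have "0 < d l"
        by (cases "d l") auto
      then have "l < L"
        using d(2) lk by (cases "l = L") auto
      have "k' < m (Suc l)"
      proof -
        have "d l * Suc k \<le> d l * m l"
          using lk by (intro mult_le_mono2) simp
        then show ?thesis
          using u by (simp add: m_Suc mult.commute)
      qed
      moreover have "k' div d l = k"
        using u by (intro div_nat_eqI) (auto simp: mult.commute)
      ultimately show "u \<in> {u \<in> V - {(0, 0)}. par u = v}"
        using u lk \<open>l < L\<close> by (auto simp: par_def)
    qed
    then show ?thesis
      using lk by (simp add: card_image inj_on_def)
  qed
  have "attains_poa ((\<Sum>v\<in>V. w v * (d (fst v))\<^sup>2) / (\<Sum>v\<in>V - {(0, 0)}. w v))"
  proof (rule attains_poa_tree[where par = par])
    show "(0, 0) \<in> V"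
      by (simp add: m_0)
    show "0 < w v" if "v \<in> V" for v
      using that A m_pos by (cases v) (auto simp: w_def)
    show "par v \<in> V" if v: "v \<in> V" for v
    proof (cases "v = (0, 0)")
      case False
      then obtain l k where "v = (Suc l, k)" "Suc l \<le> L" "k < m l * d l"
        using v V_Suc[of v] by blast
      then show ?thesis
        by (simp add: par_def less_mult_imp_div_less)
    qed (simp add: par_def m_0)
    show "par (0, 0) = (0, 0)"
      by (simp add: par_def)
    fix v assume "v \<in> V - {(0, 0)}"
    then obtain l k where v: "v = (Suc l, k)" "Suc l \<le> L" "k < m l * d l"
      using V_Suc by blast
    show "par v \<noteq> v" "par (par v) \<noteq> v"
      using v by (auto simp: par_def)
    have "A l * (d l)\<^sup>2 = A (Suc l) * (2 * d (Suc l) + 1)" "0 < m l" "0 < d l"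
      using v balance[of l] m_pos[of l] d(1)[of l] by auto
    \<comment> \<open>Division by \<open>m l * d l\<close>, the size of the next level, turns the
      balance between levels into the one along a single edge.\<close>
    then have "A l / m l * d l = A (Suc l) / (m l * d l) * (2 * d (Suc l) + 1)"
      by (simp add: field_simps power2_eq_square)
    then show "w (par v) * d (fst (par v)) \<le> w v * (2 * d (fst v) + 1)"
      using v by (simp add: w_def par_def m_Suc)
  qed (use fin card_V deg in auto)
  \<comment> \<open>Squared degrees for \<open>f\<close> give the numerator; the constant 1, less
    the root, gives the denominator.\<close>
  moreover have sum_levels: "(\<Sum>v\<in>V. w v * f (fst v)) = (\<Sum>l\<le>L. A l * f l)" for f :: "nat \<Rightarrow> real"
  proof -
    have "(\<Sum>v\<in>V. w v * f (fst v)) = (\<Sum>l\<le>L. \<Sum>k<m l. A l / m l * f l)"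
      unfolding V_def w_def by (subst sum.Sigma) (auto intro!: sum.cong)
    also have "\<dots> = (\<Sum>l\<le>L. A l * f l)"
      using m_pos by (intro sum.cong) auto
    finally show ?thesis .
  qed
  moreover have "(\<Sum>v\<in>V - {(0, 0)}. w v) = (\<Sum>l\<in>{1..L}. A l)"
  proof -
    have "(\<Sum>v\<in>V - {(0, 0)}. w v) = (\<Sum>l\<le>L. A l) - A 0"
      using sum_levels[of "\<lambda>_. 1"] fin by (simp add: sum_diff1 w_def m_0)
    also have "\<dots> = (\<Sum>l\<in>{1..L}. A l)"
      by (simp add: atMost_atLeast0 sum.atLeast_Suc_atMost)
    finally show ?thesis .
  qed
  ultimately show ?thesis
    using sum_levels[of "\<lambda>l. (d l)\<^sup>2"] by simp
qed

section \<open>Degrees 3 and 2, and the limit of the ratio\<close>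

lemma attains_poa_height:
  fixes n :: nat
  assumes n: "1 \<le> n"
  shows "attains_poa (17 / 3 - 3 * (7 / 9) ^ n - 8 / 3 * (4 / 5) ^ n)"
proof -
  define B :: real where "B = (9 / 7) ^ n"
  define q :: real where "q = (4 / 5) ^ n"
  define d :: "nat \<Rightarrow> nat" where "d l = (if l < n then 3 else if l < 2 * n then 2 else 0)" for l
  \<comment> \<open>Solution of the balance equation from \<open>A 0 = 1\<close>: the factor
    \<open>(d l)^2 / (2 * d (Suc l) + 1)\<close> is 9/7 within degree 3, 9/5 from degree 3 to 2, 4/5
    within degree 2, and 4 to the leaves. Hence 7/5 = 7/9 * 9/5 and 7 = 4 * 7/5 * 5/4.\<close>
  define A :: "nat \<Rightarrow> real" where
    "A l = (if l < n then (9 / 7) ^ l else if l < 2 * n then 7 / 5 * B * (4 / 5) ^ (l - n) else 7 * B * q)"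
    for l
  have B: "0 < B" and q: "0 < q"
    by (simp_all add: B_def q_def)
  have A_pos: "0 < A l" for l
    using B q by (simp add: A_def)
  have balance: "A l * (d l)\<^sup>2 = A (Suc l) * (2 * d (Suc l) + 1)" if l: "l < 2 * n" for l
  proof -
    consider "Suc l < n" | "Suc l = n" | "n \<le> l" "Suc l < 2 * n" | "Suc l = 2 * n"
      using l by linarith
    then show ?thesis
    proof cases
      case 1
      then show ?thesis by (simp add: A_def d_def)
    next
      case 2
      then have "B = 9 / 7 * (9 / 7) ^ l"
        by (auto simp: B_def)
      then show ?thesis
        using 2 by (simp add: A_def d_def)
    next
      case 3
      then show ?thesis by (simp add: A_def d_def Suc_diff_le)
    next
      case 4
      then have "n = Suc (l - n)" "n \<le> l"
        using n by auto
      then have "q = 4 / 5 * (4 / 5) ^ (l - n)"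
        unfolding q_def by (metis power_Suc)
      then show ?thesis
        using 4 \<open>n \<le> l\<close> by (simp add: A_def d_def)
    qed
  qed
  have split: "(\<Sum>l\<le>2 * n. f l) = (\<Sum>l<n. f l) + (\<Sum>l<n. f (n + l)) + f (2 * n)" for f :: "nat \<Rightarrow> real"
    using sum.nat_group[of f n 2] sum.atLeastLessThan_concat[of 0 n "2 * n" f]
      sum.shift_bounds_nat_ivl[of f 0 n n]
    by (simp add: lessThan_Suc_atMost[symmetric] atLeast0LessThan mult_2 add.commute)
  have geom_3: "(\<Sum>l<n. (9 / 7 :: real) ^ l) = 7 / 2 * (B - 1)"
    by (simp add: geometric_sum B_def)
  have geom_2: "(\<Sum>l<n. (4 / 5 :: real) ^ l) = 5 * (1 - q)"
    by (simp add: geometric_sum q_def)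
  have "(\<Sum>l\<le>2 * n. A l) = (\<Sum>l<n. (9 / 7) ^ l) + 7 / 5 * B * (\<Sum>l<n. (4 / 5) ^ l) + 7 * B * q"
    unfolding split by (simp add: A_def sum_distrib_left)
  \<comment> \<open>The leaf term \<open>7 * B * q\<close> cancels the tail of the second geometric
    sum.\<close>
  then have sum_A: "(\<Sum>l\<le>2 * n. A l) = 7 / 2 * (B - 1) + 7 * B"
    unfolding geom_3 geom_2 by (simp add: field_simps)
  have "(\<Sum>l\<le>2 * n. A l * (d l)\<^sup>2) =
      9 * (\<Sum>l<n. (9 / 7) ^ l) + 28 / 5 * B * (\<Sum>l<n. (4 / 5) ^ l)"
    unfolding split by (simp add: A_def d_def sum_distrib_left mult_ac)
  then have sum_Ad: "(\<Sum>l\<le>2 * n. A l * (d l)\<^sup>2) = 63 / 2 * (B - 1) + 28 * B * (1 - q)"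
    unfolding geom_3 geom_2 by (simp add: field_simps)
  \<comment> \<open>Including the root only enlarges the denominator, which then has a closed
    form.\<close>
  have "(\<Sum>l\<in>{1..2 * n}. A l) \<le> (\<Sum>l\<le>2 * n. A l)"
    using A_pos by (intro sum_mono2) (auto intro: less_imp_le)
  also have "\<dots> \<le> 21 / 2 * B"
    unfolding sum_A by (simp add: field_simps)
  finally have opt_le: "(\<Sum>l\<in>{1..2 * n}. A l) \<le> 21 / 2 * B" .
  have opt_pos: "0 < (\<Sum>l\<in>{1..2 * n}. A l)"
    using n A_pos by (intro sum_pos) auto
  have "17 / 3 - 3 * (7 / 9) ^ n - 8 / 3 * (4 / 5) ^ n = 17 / 3 - 3 / B - 8 / 3 * q"
    by (simp add: B_def q_def power_divide)
  \<comment> \<open>The two parts contribute \<open>3 * (1 - 1 / B)\<close> and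
    \<open>8 / 3 * (1 - q)\<close>: the losses come from the start of the growing series and the end
    of the shrinking one.\<close>
  also have "\<dots> = (63 / 2 * (B - 1) + 28 * B * (1 - q)) / (21 / 2 * B)"
    using B by (simp add: field_simps)
  also have "\<dots> = (\<Sum>l\<le>2 * n. A l * (d l)\<^sup>2) / (21 / 2 * B)"
    by (simp only: sum_Ad)
  also have "\<dots> \<le> (\<Sum>l\<le>2 * n. A l * (d l)\<^sup>2) / (\<Sum>l\<in>{1..2 * n}. A l)"
    using opt_le opt_pos B A_pos
    by (intro divide_left_mono sum_nonneg mult_nonneg_nonneg) (auto intro: less_imp_le)
  finally have le: "17 / 3 - 3 * (7 / 9) ^ n - 8 / 3 * (4 / 5) ^ n \<le>
      (\<Sum>l\<le>2 * n. A l * (d l)\<^sup>2) / (\<Sum>l\<in>{1..2 * n}. A l)" .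
  have "attains_poa ((\<Sum>l\<le>2 * n. A l * (d l)\<^sup>2) / (\<Sum>l\<in>{1..2 * n}. A l))"
    by (rule attains_poa_levels) (use n A_pos balance in \<open>auto simp: d_def\<close>)
  then show ?thesis
    using le by (rule attains_poa_mono)
qed

theorem theorem5:
  fixes \<epsilon> :: real
  assumes "\<epsilon> > 0"
  shows "\<exists>(G :: nat congestion_game) (\<Gamma> :: social_context).
           linear_congestion_game G \<and> load_balancing_game G \<and>
           restricted_context G \<Gamma> \<and> normalized_context G \<Gamma> \<and>
           symmetric_context G \<Gamma> \<and> boolean_context G \<Gamma> \<and>
           pure_nash_equilibria G \<Gamma> \<noteq> {} \<and> optimal_social_cost G > 0 \<and>
           price_of_anarchy G \<Gamma> \<ge> 17 / 3 - \<epsilon>"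
proof -
  \<comment> \<open>Both losses decay geometrically, so some height \<open>n\<close> brings them
    below \<open>\<epsilon>\<close>.\<close>
  have "(\<lambda>n. 3 * (7 / 9) ^ n + 8 / 3 * (4 / 5) ^ n :: real) \<longlonglongrightarrow> 3 * 0 + 8 / 3 * 0"
    by (intro tendsto_intros LIMSEQ_power_zero) auto
  then have "\<forall>\<^sub>F n in sequentially. 3 * (7 / 9) ^ n + 8 / 3 * (4 / 5) ^ n < \<epsilon>"
    using assms by (intro order_tendstoD(2)) auto
  then obtain n where "1 \<le> n" and n: "3 * (7 / 9) ^ n + 8 / 3 * (4 / 5) ^ n < \<epsilon>"
    unfolding eventually_sequentially by (metis nat_le_linear)
  have "attains_poa (17 / 3 - \<epsilon>)"
    using attains_poa_height[OF \<open>1 \<le> n\<close>] by (rule attains_poa_mono) (use n in simp)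
  then show ?thesis
    unfolding attains_poa_def .
qed

end
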